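(* Let $X_1,\ldots,X_n,Y_1,\ldots,Y_n$ be random variables with distributions $F_1,\ldots,F_n,G_1,\ldots,G_n$ respectively, all from the class $\mathcal{D}\cap\mathcal{L}$. Suppose that $X_1,\ldots,X_n,Y_1,\ldots,Y_n$ are generalized tail asymptotically independent (GTAI) and that $(X_k,Y_l)\in(\mathcal{D}\cap\mathcal{L})^{(2)}$ for all $k,l\in\{1,\ldots,n\}$. Suppose further that $X_1,\ldots,X_n$ are tail asymptotically independent (TAI) and that $Y_1,\ldots,Y_n$ are TAI. Put $S_i=\sum_{k=1}^i X_k$ and $T_j=\sum_{l=1}^j Y_l$. Then, as $x\wedge y\to\infty$, $$\mathbf{P}\Big[\sum_{k=1}^n X_k>x,\ \sum_{l=1}^n Y_l>y\Big]\sim \mathbf{P}\Big[\max_{1\le i\le n} S_i>x,\ \max_{1\le j\le n}T_j>y\Big]\sim \mathbf{P}\Big[\max_{1\le k\le n}X_k>x,\ \max_{1\le l\le n}Y_l>y\Big]\sim\sum_{k=1}^n\sum_{l=1}^n\mathbf{P}[X_k>x,\ Y_l>y].$$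
   Context: Notation: $x\wedge y=\min\{x,y\}$; $f(x,y)\sim g(x,y)$ as $x\wedge y\to\infty$ means $\lim_{x\wedge y\to\infty} f(x,y)/g(x,y)=1$. For a distribution $F$ on $\mathbb{R}$, $\overline F=1-F$; all distributions satisfy $\overline F(x)>0$ for all $x\ge 0$. Joint tails appearing in denominators or as conditioning events are implicitly assumed positive. One-dimensional classes: $F\in\mathcal{L}$ (long-tailed) if $\lim_{x\to\infty}\overline F(x-a)/\overline F(x)=1$ for every $a>0$. $F\in\mathcal{D}$ (dominatedly varying) if $\limsup_{x\to\infty}\overline F(bx)/\overline F(x)<\infty$ for some (equivalently all) $b\in(0,1)$. Two-dimensional classes: let $(X,Y)$ have marginal distributions $F,G$. We write $(X,Y)\in\mathcal{L}^{(2)}$ (or $(F,G)\in\mathcal{L}^{(2)}$) if $F,G\in\mathcal{L}$ and $\lim_{x\wedge y\to\infty}\mathbf{P}[X>x-a_1,Y>y-a_2]/\mathbf{P}[X>x,Y>y]=1$ for every $(a_1,a_2)\in[0,\infty)^2\setminus\{(0,0)\}$. We write $(X,Y)\in\mathcal{D}^{(2)}$ if $F,G\in\mathcal{D}$ and $\limsup_{x\wedge y\to\infty}\mathbf{P}[X>b_1x,Y>b_2y]/\mathbf{P}[X>x,Y>y]<\infty$ for some (equivalently all) $(b_1,b_2)\in(0,1)^2$. Finally $(\mathcal{D}\cap\mathcal{L})^{(2)}=\mathcal{D}^{(2)}\cap\mathcal{L}^{(2)}$. GTAI: $X_1,\ldots,X_n,Y_1,\ldots,Y_m$ are GTAI if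 (1) $\lim_{\min\{x_i,x_k,y_j\}\to\infty}\mathbf{P}[|X_i|>x_i\mid X_k>x_k,Y_j>y_j]=0$ for all $1\le i\ne k\le n$, $1\le j\le m$; and (2) $\lim_{\min\{x_i,y_k,y_j\}\to\infty}\mathbf{P}[|Y_j|>y_j\mid X_i>x_i,Y_k>y_k]=0$ for all $1\le j\ne k\le m$, $1\le i\le n$. TAI: $X_1,\ldots,X_n$ are TAI if $\lim_{x_i\wedge x_j\to\infty}\mathbf{P}[|X_i|>x_i\mid X_j>x_j]=0$ for all $i\ne j$ in $\{1,\ldots,n\}$. *)

theory Defs
  imports "HOL-Probability.Probability"
begin

text \<open>
  One-dimensional classes are predicates on distribution functions. The marginal distribution
  of \<open>X\<close> is \<open>cdf (distr M borel X)\<close>, so \<open>1 - F x\<close> is the tail of \<open>F\<close> at \<open>x\<close>.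
\<close>

definition long_tailed :: "(real \<Rightarrow> real) \<Rightarrow> bool" where
  "long_tailed F \<longleftrightarrow> (\<forall>a>0. ((\<lambda>x. (1 - F (x - a)) / (1 - F x)) \<longlongrightarrow> 1) at_top)"

definition dominatedly_varying :: "(real \<Rightarrow> real) \<Rightarrow> bool" where
  "dominatedly_varying F \<longleftrightarrow>
     (\<exists>b\<in>{0<..<1}. Limsup at_top (\<lambda>x. ereal ((1 - F (b * x)) / (1 - F x))) < \<infinity>)"

text \<open>
  Throughout, a limit as the minimum of several real variables tends to infinity is a limit
  along the product filter \<open>at_top \<times>\<^sub>F at_top\<close> (or its triple version), whose
  basic sets are those where all variables exceed a common threshold.
\<close>

definition joint_tail ::
    "'a measure \<Rightarrow> ('a \<Rightarrow> real) \<Rightarrow> ('a \<Rightarrow> real) \<Rightarrow> real \<Rightarrow> real \<Rightarrow> real" where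
  "joint_tail M X Y x y = \<P>(\<omega> in M. X \<omega> > x \<and> Y \<omega> > y)"

definition long_tailed2 :: "'a measure \<Rightarrow> ('a \<Rightarrow> real) \<Rightarrow> ('a \<Rightarrow> real) \<Rightarrow> bool" where
  "long_tailed2 M X Y \<longleftrightarrow>
     long_tailed (cdf (distr M borel X)) \<and> long_tailed (cdf (distr M borel Y)) \<and>
     (\<forall>a1\<ge>0. \<forall>a2\<ge>0. (a1, a2) \<noteq> (0, 0) \<longrightarrow>
        ((\<lambda>(x, y). joint_tail M X Y (x - a1) (y - a2) / joint_tail M X Y x y) \<longlongrightarrow> 1)
          (at_top \<times>\<^sub>F at_top))"

definition dominatedly_varying2 :: "'a measure \<Rightarrow> ('a \<Rightarrow> real) \<Rightarrow> ('a \<Rightarrow> real) \<Rightarrow> bool" where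
  "dominatedly_varying2 M X Y \<longleftrightarrow>
     dominatedly_varying (cdf (distr M borel X)) \<and> dominatedly_varying (cdf (distr M borel Y)) \<and>
     (\<exists>b1\<in>{0<..<1}. \<exists>b2\<in>{0<..<1}.
        Limsup (at_top \<times>\<^sub>F at_top)
          (\<lambda>(x, y). ereal (joint_tail M X Y (b1 * x) (b2 * y) / joint_tail M X Y x y)) < \<infinity>)"

definition GTAI ::
    "'a measure \<Rightarrow> nat \<Rightarrow> nat \<Rightarrow> (nat \<Rightarrow> 'a \<Rightarrow> real) \<Rightarrow> (nat \<Rightarrow> 'a \<Rightarrow> real) \<Rightarrow> bool" where
  "GTAI M n m X Y \<longleftrightarrow>
     (\<forall>i\<in>{1..n}. \<forall>k\<in>{1..n}. \<forall>j\<in>{1..m}. i \<noteq> k \<longrightarrow>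
        ((\<lambda>(xi, xk, yj). \<P>(\<omega> in M. abs (X i \<omega>) > xi \<bar> X k \<omega> > xk \<and> Y j \<omega> > yj)) \<longlongrightarrow> 0)
          (at_top \<times>\<^sub>F at_top \<times>\<^sub>F at_top)) \<and>
     (\<forall>j\<in>{1..m}. \<forall>k\<in>{1..m}. \<forall>i\<in>{1..n}. j \<noteq> k \<longrightarrow>
        ((\<lambda>(xi, yk, yj). \<P>(\<omega> in M. abs (Y j \<omega>) > yj \<bar> X i \<omega> > xi \<and> Y k \<omega> > yk)) \<longlongrightarrow> 0)
          (at_top \<times>\<^sub>F at_top \<times>\<^sub>F at_top))"

definition TAI :: "'a measure \<Rightarrow> nat \<Rightarrow> (nat \<Rightarrow> 'a \<Rightarrow> real) \<Rightarrow> bool" where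
  "TAI M n X \<longleftrightarrow>
     (\<forall>i\<in>{1..n}. \<forall>j\<in>{1..n}. i \<noteq> j \<longrightarrow>
        ((\<lambda>(xi, xj). \<P>(\<omega> in M. abs (X i \<omega>) > xi \<bar> X j \<omega> > xj)) \<longlongrightarrow> 0)
          (at_top \<times>\<^sub>F at_top))"

text \<open>
  Since \<open>u / 0 = 0\<close>, the following forces the denominator to be eventually nonzero,
  as is implicit in writing the quotient.
\<close>

definition asymp2 :: "(real \<Rightarrow> real \<Rightarrow> real) \<Rightarrow> (real \<Rightarrow> real \<Rightarrow> real) \<Rightarrow> bool" where
  "asymp2 f g \<longleftrightarrow> ((\<lambda>(x, y). f x y / g x y) \<longlongrightarrow> 1) (at_top \<times>\<^sub>F at_top)"

end

theory Submission
  imports Defs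
begin

text \<open>
  The principle of a single big jump holds in each of the two coordinates. Call the event that
  \<open>X k\<close> exceeds about \<open>x\<close> and \<open>Y l\<close> exceeds about \<open>y\<close>, while all other \<open>X i\<close> and \<open>Y j\<close> stay
  below a large constant \<open>u\<close> in absolute value, the lone jump of the pair \<open>(k, l)\<close>. For distinct
  pairs these events are disjoint. On a lone jump that overshoots \<open>x\<close> and \<open>y\<close> by a suitable
  constant \<open>v\<close>, the bounded variables cannot bring the sums back below \<open>x\<close> and \<open>y\<close>, so the sums,
  the maximal partial sums and the maxima all exceed \<open>x\<close> and \<open>y\<close>. Conversely, if any of these
  three pairs exceeds \<open>x\<close> and \<open>y\<close>, then so do the sums of the positive parts, and then either
  some pair comes within \<open>v\<close> of \<open>x\<close> and \<open>y\<close>, or some pair exceeds a fixed fraction of \<open>x\<close> and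
  \<open>y\<close> while a further variable exceeds \<open>u\<close>.

  Up to a factor close to 1, both bounds equal the double sum of joint tails. Generalized tail asymptotic
  independence makes the presence of a further variable above \<open>u\<close> negligible relative to the joint
  tail (\<open>other_exceeds_negligible\<close>). Dominated variation replaces the fraction of \<open>x\<close> and \<open>y\<close> by
  \<open>x\<close> and \<open>y\<close> at the cost of a constant factor (\<open>dominatedly_varying2_scale\<close>), and long-tailedness
  removes the constant \<open>v\<close> (\<open>long_tailed2_shift\<close>). Since the three probabilities lie between
  the same two bounds, one lemma, \<open>asymp2_sum_joint_tails\<close>, treats all of them.
\<close>

section \<open>Limits as the minimum of the variables tends to infinity\<close>

lemma eventually_at_top_prod2:
  "eventually P (at_top \<times>\<^sub>F at_top) \<longleftrightarrow> (\<exists>N::real. \<forall>x\<ge>N. \<forall>y\<ge>N. P (x, y :: real))"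
proof
  assume "eventually P (at_top \<times>\<^sub>F at_top)"
  then obtain Q R where "eventually Q (at_top :: real filter)" "eventually R (at_top :: real filter)"
    and QR: "\<And>x y. Q x \<Longrightarrow> R y \<Longrightarrow> P (x, y)"
    unfolding eventually_prod_filter by auto
  then obtain K L where "\<And>x. x \<ge> K \<Longrightarrow> Q x" "\<And>y. y \<ge> L \<Longrightarrow> R y"
    unfolding eventually_at_top_linorder by auto
  then have "\<forall>x\<ge>max K L. \<forall>y\<ge>max K L. P (x, y)"
    using QR by simp
  then show "\<exists>N. \<forall>x\<ge>N. \<forall>y\<ge>N. P (x, y)" ..
next
  assume "\<exists>N. \<forall>x\<ge>N. \<forall>y\<ge>N. P (x, y)"
  then obtain N where "\<And>x y. x \<ge> N \<Longrightarrow> y \<ge> N \<Longrightarrow> P (x, y)" by auto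
  then show "eventually P (at_top \<times>\<^sub>F at_top)"
    unfolding eventually_prod_filter
    by (intro exI[of _ "\<lambda>x. x \<ge> N"]) (auto intro: eventually_ge_at_top)
qed

lemma eventually_at_top_prod3:
  assumes "eventually P (at_top \<times>\<^sub>F at_top \<times>\<^sub>F at_top)"
  shows "\<exists>N::real. \<forall>u\<ge>N. \<forall>x\<ge>N. \<forall>y\<ge>N. P (u, x :: real, y :: real)"
proof -
  obtain Q R where "eventually Q (at_top :: real filter)"
    and R: "eventually R (at_top \<times>\<^sub>F at_top :: (real \<times> real) filter)"
    and QR: "\<And>u z. Q u \<Longrightarrow> R z \<Longrightarrow> P (u, z)"
    using assms unfolding eventually_prod_filter[of _ _ "_ \<times>\<^sub>F _"] by auto
  then obtain K where K: "\<And>u. u \<ge> K \<Longrightarrow> Q u"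
    unfolding eventually_at_top_linorder by auto
  obtain L where L: "\<And>x y. x \<ge> L \<Longrightarrow> y \<ge> L \<Longrightarrow> R (x, y)"
    using R unfolding eventually_at_top_prod2 by auto
  show ?thesis
    by (intro exI[of _ "max K L"]) (simp add: K L QR)
qed

lemma asymp2_trans_common:
  assumes "asymp2 f h" "asymp2 g h"
    and pos: "\<forall>\<^sub>F (x, y) in at_top \<times>\<^sub>F at_top. h x y > 0"
  shows "asymp2 f g"
proof -
  have "((\<lambda>(x, y). (f x y / h x y) / (g x y / h x y)) \<longlongrightarrow> 1 / 1) (at_top \<times>\<^sub>F at_top)"
    using assms(1,2) unfolding asymp2_def case_prod_unfold by (intro tendsto_divide) auto
  moreover have "\<forall>\<^sub>F (x, y) in at_top \<times>\<^sub>F at_top.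
      (f x y / h x y) / (g x y / h x y) = f x y / g x y"
    using pos by (auto elim!: eventually_mono)
  ultimately have "((\<lambda>(x, y). f x y / g x y) \<longlongrightarrow> 1 / 1) (at_top \<times>\<^sub>F at_top)"
    by (rule Lim_transform_eventually[OF _ eventually_mono]) auto
  then show ?thesis unfolding asymp2_def by simp
qed

lemma asymp2I:
  assumes pos: "\<forall>\<^sub>F (x, y) in at_top \<times>\<^sub>F at_top. h x y > 0"
    and bounds: "\<And>\<epsilon>. \<epsilon> > 0 \<Longrightarrow> \<forall>\<^sub>F (x, y) in at_top \<times>\<^sub>F at_top.
      (1 - \<epsilon>) * h x y \<le> f x y \<and> f x y \<le> (1 + \<epsilon>) * h x y"
  shows "asymp2 f h"
  unfolding asymp2_def
proof (rule tendstoI)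
  fix e :: real assume "e > 0"
  then have "e / 2 > 0" by simp
  from pos bounds[OF this]
  show "\<forall>\<^sub>F z in at_top \<times>\<^sub>F at_top. dist (case z of (x, y) \<Rightarrow> f x y / h x y) 1 < e"
  proof eventually_elim
    case (elim z)
    obtain x y where z: "z = (x, y)" by force
    have h: "h x y > 0" and "(1 - e / 2) * h x y \<le> f x y" "f x y \<le> (1 + e / 2) * h x y"
      using elim z by auto
    then have "1 - e / 2 \<le> f x y / h x y" "f x y / h x y \<le> 1 + e / 2"
      by (simp_all add: field_simps)
    then show ?case using \<open>e > 0\<close> unfolding z dist_real_def by simp
  qed
qed

section \<open>Sums with one large summand\<close>

text \<open>
  Some summand reaches the average. If it falls short of \<open>x\<close> by \<open>a\<close> or more, the others
  contribute more than \<open>a\<close> together, so a second summand exceeds \<open>u\<close>.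
\<close>

lemma sum_pos_part_gt_cases:
  fixes X :: "'i \<Rightarrow> real" and a c u x :: real
  assumes "finite I" "0 \<le> x" "0 \<le> u" "card I * c \<le> 1" "card I * u \<le> a"
    and gt: "(\<Sum>i\<in>I. max 0 (X i)) > x"
  obtains k where "k \<in> I" "X k > c * x" "X k > x - a \<or> (\<exists>i\<in>I - {k}. X i > u)"
proof -
  have "I \<noteq> {}" using gt \<open>0 \<le> x\<close> by auto
  then have card: "card I > 0" using \<open>finite I\<close> by (simp add: card_gt_0_iff)
  have "\<exists>k\<in>I. max 0 (X k) > x / card I"
  proof (rule ccontr)
    assume "\<not> ?thesis"
    then have "(\<Sum>i\<in>I. max 0 (X i)) \<le> card I * (x / card I)"
      by (intro sum_bounded_above) force
    then show False using gt card by simp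
  qed
  then obtain k where k: "k \<in> I" "max 0 (X k) > x / card I" by auto
  have "x / card I \<ge> 0" using \<open>0 \<le> x\<close> by simp
  then have Xk: "X k > x / card I" and k0: "X k > 0" using k by auto
  have "c \<le> 1 / card I" using card assms(4) by (simp add: field_simps)
  then have "c * x \<le> x / card I" using mult_right_mono[of c "1 / card I" x] \<open>0 \<le> x\<close> by simp
  with Xk have "X k > c * x" by simp
  moreover have "\<exists>i\<in>I - {k}. X i > u" if "\<not> X k > x - a"
  proof (rule ccontr)
    assume "\<not> ?thesis"
    then have "(\<Sum>i\<in>I - {k}. max 0 (X i)) \<le> card (I - {k}) * u"
      using \<open>0 \<le> u\<close> by (intro sum_bounded_above) force
    also have "\<dots> \<le> card I * u"
      using \<open>finite I\<close> \<open>0 \<le> u\<close> by (intro mult_right_mono) (auto intro: card_mono)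
    also have "\<dots> \<le> a" by fact
    finally have "(\<Sum>i\<in>I. max 0 (X i)) \<le> X k + a"
      using \<open>finite I\<close> k k0 by (simp add: sum.remove)
    then show False using gt that by simp
  qed
  ultimately show thesis using k that by blast
qed

lemma sum_gt_of_one_large:
  fixes X :: "'i \<Rightarrow> real" and a u x :: real
  assumes "finite I" "k \<in> I" "0 \<le> u" "card I * u \<le> a" "X k > x + a"
    and small: "\<And>i. i \<in> I - {k} \<Longrightarrow> \<bar>X i\<bar> \<le> u"
  shows "(\<Sum>i\<in>I. X i) > x"
proof -
  have "\<bar>\<Sum>i\<in>I - {k}. X i\<bar> \<le> (\<Sum>i\<in>I - {k}. \<bar>X i\<bar>)" by (rule sum_abs)
  also have "\<dots> \<le> card (I - {k}) * u"
    using small by (intro sum_bounded_above) auto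
  also have "\<dots> \<le> card I * u"
    using \<open>finite I\<close> \<open>0 \<le> u\<close> by (intro mult_right_mono) (auto intro: card_mono)
  also have "\<dots> \<le> a" by fact
  finally show ?thesis
    using assms(1,2,5) by (simp add: sum.remove)
qed

lemma Max_partial_sums_le_sum_pos_part:
  fixes X :: "nat \<Rightarrow> real"
  assumes "n \<ge> 1"
  shows "(MAX i\<in>{1..n}. \<Sum>k=1..i. X k) \<le> (\<Sum>k=1..n. max 0 (X k))"
proof -
  have "(\<Sum>k=1..i. X k) \<le> (\<Sum>k=1..n. max 0 (X k))" if "i \<le> n" for i
  proof -
    have "(\<Sum>k=1..i. X k) \<le> (\<Sum>k=1..i. max 0 (X k))" by (intro sum_mono) auto
    also have "\<dots> \<le> (\<Sum>k=1..n. max 0 (X k))" using that by (intro sum_mono2) auto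
    finally show ?thesis .
  qed
  then show ?thesis using assms by (subst Max_le_iff) auto
qed

section \<open>Joint tails\<close>

lemma (in prob_space) joint_tail_antimono:
  assumes [measurable]: "U \<in> borel_measurable M" "V \<in> borel_measurable M"
    and "x' \<le> x" "y' \<le> y"
  shows "joint_tail M U V x y \<le> joint_tail M U V x' y'"
  unfolding joint_tail_def by (rule finite_measure_mono) (use assms(3,4) in auto)

text \<open>
  The factor \<open>c\<close> is reached from the two factors \<open>b1\<close>, \<open>b2\<close> in the definition of dominated
  variation by iteration: the bound by \<open>C\<close> turns into one by \<open>C ^ p\<close> once both
  \<open>b1 ^ p\<close> and \<open>b2 ^ p\<close> lie below \<open>c\<close>.
\<close>

lemma (in prob_space) dominatedly_varying2_scale:
  assumes [measurable]: "U \<in> borel_measurable M" "V \<in> borel_measurable M"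
    and pos: "\<And>x y. x \<ge> 0 \<Longrightarrow> y \<ge> 0 \<Longrightarrow> joint_tail M U V x y > 0"
    and dom: "dominatedly_varying2 M U V" and "0 < (c::real)"
  obtains C where "C > 0"
    "\<forall>\<^sub>F (x, y) in at_top \<times>\<^sub>F at_top. joint_tail M U V (c * x) (c * y) \<le> C * joint_tail M U V x y"
proof -
  let ?J = "joint_tail M U V"
  obtain b1 b2 where b: "0 < b1" "b1 < 1" "0 < b2" "b2 < 1"
    and ls: "Limsup (at_top \<times>\<^sub>F at_top) (\<lambda>(x, y). ereal (?J (b1 * x) (b2 * y) / ?J x y)) < \<infinity>"
    using dom unfolding dominatedly_varying2_def by auto
  obtain C where C: "Limsup (at_top \<times>\<^sub>F at_top) (\<lambda>(x, y). ereal (?J (b1 * x) (b2 * y) / ?J x y)) < ereal C"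
    using ereal_dense2[OF ls] by auto
  obtain N where N: "\<And>x y. x \<ge> N \<Longrightarrow> y \<ge> N \<Longrightarrow> ?J (b1 * x) (b2 * y) / ?J x y < C"
    using Limsup_lessD[OF C] unfolding eventually_at_top_prod2 by auto
  define D where "D = max C 1"
  define N' where "N' = max N 0"
  have step: "?J (b1 * x) (b2 * y) \<le> D * ?J x y" if "x \<ge> N'" "y \<ge> N'" for x y
  proof -
    have "x \<ge> 0" "y \<ge> 0" "x \<ge> N" "y \<ge> N" using that by (auto simp: N'_def)
    then have "?J (b1 * x) (b2 * y) \<le> C * ?J x y"
      using N[of x y] pos[of x y] by (simp add: field_simps)
    also have "\<dots> \<le> D * ?J x y"
      using pos[of x y] \<open>x \<ge> 0\<close> \<open>y \<ge> 0\<close> by (intro mult_right_mono) (auto simp: D_def)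
    finally show ?thesis .
  qed
  have iterate: "\<exists>K. \<forall>x\<ge>K. \<forall>y\<ge>K. ?J (b1 ^ p * x) (b2 ^ p * y) \<le> D ^ p * ?J x y" for p
  proof (induction p)
    case (Suc p)
    then obtain K where K: "\<And>x y. x \<ge> K \<Longrightarrow> y \<ge> K \<Longrightarrow> ?J (b1 ^ p * x) (b2 ^ p * y) \<le> D ^ p * ?J x y"
      by auto
    have "?J (b1 ^ Suc p * x) (b2 ^ Suc p * y) \<le> D ^ Suc p * ?J x y"
      if "x \<ge> max K (max (N' / b1 ^ p) (N' / b2 ^ p))"
         "y \<ge> max K (max (N' / b1 ^ p) (N' / b2 ^ p))" for x y
    proof -
      have "N' \<le> b1 ^ p * x" "N' \<le> b2 ^ p * y"
        using that b by (auto simp: field_simps)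
      then have "?J (b1 * (b1 ^ p * x)) (b2 * (b2 ^ p * y)) \<le> D * ?J (b1 ^ p * x) (b2 ^ p * y)"
        by (rule step)
      also have "\<dots> \<le> D * (D ^ p * ?J x y)"
        using K[of x y] that by (intro mult_left_mono) (auto simp: D_def)
      finally show ?thesis by (simp add: mult.assoc)
    qed
    then show ?case by blast
  qed auto
  obtain p1 where p1: "b1 ^ p1 < c" using b \<open>0 < c\<close> real_arch_pow_inv by blast
  obtain p2 where p2: "b2 ^ p2 < c" using b \<open>0 < c\<close> real_arch_pow_inv by blast
  define p where "p = max p1 p2"
  have "b1 ^ p \<le> b1 ^ p1" "b2 ^ p \<le> b2 ^ p2" using b by (auto simp: p_def intro!: power_decreasing)
  then have bp: "b1 ^ p \<le> c" "b2 ^ p \<le> c" using p1 p2 by auto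
  obtain K where K: "\<And>x y. x \<ge> K \<Longrightarrow> y \<ge> K \<Longrightarrow> ?J (b1 ^ p * x) (b2 ^ p * y) \<le> D ^ p * ?J x y"
    using iterate[of p] by auto
  have "?J (c * x) (c * y) \<le> D ^ p * ?J x y" if "x \<ge> max K 0" "y \<ge> max K 0" for x y
  proof -
    have "?J (c * x) (c * y) \<le> ?J (b1 ^ p * x) (b2 ^ p * y)"
      using bp that by (intro joint_tail_antimono mult_right_mono) auto
    also have "\<dots> \<le> D ^ p * ?J x y" using K[of x y] that by simp
    finally show ?thesis .
  qed
  then have "\<forall>\<^sub>F (x, y) in at_top \<times>\<^sub>F at_top. ?J (c * x) (c * y) \<le> D ^ p * ?J x y"
    unfolding eventually_at_top_prod2 by (intro exI[of _ "max K 0"]) simp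
  moreover have "D ^ p > 0" by (simp add: D_def)
  ultimately show thesis by (rule that[rotated])
qed

lemma long_tailed2_shift:
  assumes pos: "\<And>x y. x \<ge> 0 \<Longrightarrow> y \<ge> 0 \<Longrightarrow> joint_tail M U V x y > 0"
    and "long_tailed2 M U V" "0 < a" "0 < \<epsilon>"
  shows "\<forall>\<^sub>F (x, y) in at_top \<times>\<^sub>F at_top.
           joint_tail M U V (x - a) (y - a) \<le> (1 + \<epsilon>) * joint_tail M U V x y"
proof -
  let ?J = "joint_tail M U V"
  have "((\<lambda>(x, y). ?J (x - a) (y - a) / ?J x y) \<longlongrightarrow> 1) (at_top \<times>\<^sub>F at_top)"
    using assms(2,3) unfolding long_tailed2_def by simp
  then have "\<forall>\<^sub>F z in at_top \<times>\<^sub>F at_top. (\<lambda>(x, y). ?J (x - a) (y - a) / ?J x y) z < 1 + \<epsilon>"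
    by (rule order_tendstoD) (use \<open>0 < \<epsilon>\<close> in simp)
  then obtain N where N: "\<And>x y. x \<ge> N \<Longrightarrow> y \<ge> N \<Longrightarrow> ?J (x - a) (y - a) / ?J x y < 1 + \<epsilon>"
    unfolding eventually_at_top_prod2 by auto
  have "?J (x - a) (y - a) \<le> (1 + \<epsilon>) * ?J x y" if "x \<ge> max N 0" "y \<ge> max N 0" for x y
    using N[of x y] pos[of x y] that by (simp add: field_simps)
  then show ?thesis unfolding eventually_at_top_prod2 by (intro exI[of _ "max N 0"]) auto
qed

section \<open>Two families of generalized tail asymptotically independent variables\<close>

locale gtai_families = prob_space M for M :: "'a measure" +
  fixes n m :: nat and X Y :: "nat \<Rightarrow> 'a \<Rightarrow> real"
  assumes nonempty: "n \<ge> 1" "m \<ge> 1"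
    and meas [measurable]:
      "\<And>k. k \<in> {1..n} \<Longrightarrow> X k \<in> borel_measurable M"
      "\<And>l. l \<in> {1..m} \<Longrightarrow> Y l \<in> borel_measurable M"
    and joint_tail_pos: "\<And>k l x y. k \<in> {1..n} \<Longrightarrow> l \<in> {1..m} \<Longrightarrow> x \<ge> 0 \<Longrightarrow> y \<ge> 0
           \<Longrightarrow> joint_tail M (X k) (Y l) x y > 0"
    and gtai: "GTAI M n m X Y"
    and dominated: "\<And>k l. k \<in> {1..n} \<Longrightarrow> l \<in> {1..m} \<Longrightarrow> dominatedly_varying2 M (X k) (Y l)"
    and long: "\<And>k l. k \<in> {1..n} \<Longrightarrow> l \<in> {1..m} \<Longrightarrow> long_tailed2 M (X k) (Y l)"
begin

abbreviation J :: "nat \<Rightarrow> nat \<Rightarrow> real \<Rightarrow> real \<Rightarrow> real" where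
  "J k l \<equiv> joint_tail M (X k) (Y l)"

definition other_exceeds :: "nat \<Rightarrow> nat \<Rightarrow> real \<Rightarrow> 'a \<Rightarrow> bool" where
  "other_exceeds k l u \<omega> \<longleftrightarrow>
     (\<exists>i\<in>{1..n} - {k}. \<bar>X i \<omega>\<bar> > u) \<or> (\<exists>j\<in>{1..m} - {l}. \<bar>Y j \<omega>\<bar> > u)"

lemma measurable_other_exceeds [measurable]: "Measurable.pred M (other_exceeds k l u)"
proof -
  have "Measurable.pred M (\<lambda>\<omega>. (\<exists>i\<in>{1..n} - {k}. \<bar>X i \<omega>\<bar> > u) \<or> (\<exists>j\<in>{1..m} - {l}. \<bar>Y j \<omega>\<bar> > u))"
    by measurable
  then show ?thesis unfolding other_exceeds_def[abs_def] .
qed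

text \<open>
  The threshold \<open>u\<close> for the other variables need not grow with \<open>x\<close> and \<open>y\<close>, because the limit
  in the definition of GTAI is joint in all three variables. A large constant \<open>u\<close> is enough, and
  this is what later allows long-tailedness to absorb the other variables' share of the sums.
\<close>

lemma other_exceeds_negligible:
  assumes kl: "k \<in> {1..n}" "l \<in> {1..m}" and "\<epsilon> > 0"
  obtains N where "\<And>u x y. u \<ge> N \<Longrightarrow> x \<ge> N \<Longrightarrow> y \<ge> N \<Longrightarrow>
    \<P>(\<omega> in M. (X k \<omega> > x \<and> Y l \<omega> > y) \<and> other_exceeds k l u \<omega>) \<le> \<epsilon> * J k l x y"
proof -
  \<comment> \<open>There are fewer than \<open>n + m\<close> other variables.\<close>
  define \<delta> where "\<delta> = \<epsilon> / (n + m)"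
  have "\<delta> > 0" using \<open>\<epsilon> > 0\<close> nonempty by (simp add: \<delta>_def)
  have cond: "\<P>(\<omega> in M. A \<omega> \<and> (X k \<omega> > x \<and> Y l \<omega> > y)) \<le> \<delta> * J k l x y"
    if "cond_prob M A (\<lambda>\<omega>. X k \<omega> > x \<and> Y l \<omega> > y) < \<delta>" "x \<ge> 0" "y \<ge> 0" for A x y
    using that(1) joint_tail_pos[OF kl that(2,3)]
    unfolding cond_prob_def joint_tail_def by (simp add: pos_divide_less_eq)
  have "\<exists>N. \<forall>u\<ge>N. \<forall>x\<ge>N. \<forall>y\<ge>N.
      \<P>(\<omega> in M. \<bar>X i \<omega>\<bar> > u \<and> (X k \<omega> > x \<and> Y l \<omega> > y)) \<le> \<delta> * J k l x y"
    if "i \<in> {1..n} - {k}" for i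
  proof -
    have "((\<lambda>(xi, xk, yj). \<P>(\<omega> in M. \<bar>X i \<omega>\<bar> > xi \<bar> X k \<omega> > xk \<and> Y l \<omega> > yj)) \<longlongrightarrow> 0)
        (at_top \<times>\<^sub>F at_top \<times>\<^sub>F at_top)"
      using gtai that kl unfolding GTAI_def by blast
    then have "\<forall>\<^sub>F z in at_top \<times>\<^sub>F at_top \<times>\<^sub>F at_top.
        (\<lambda>(xi, xk, yj). \<P>(\<omega> in M. \<bar>X i \<omega>\<bar> > xi \<bar> X k \<omega> > xk \<and> Y l \<omega> > yj)) z < \<delta>"
      by (rule order_tendstoD) (use \<open>\<delta> > 0\<close> in simp)
    from eventually_at_top_prod3[OF this] obtain N where N: "\<And>u x y. u \<ge> N \<Longrightarrow> x \<ge> N \<Longrightarrow> y \<ge> N \<Longrightarrow>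
        \<P>(\<omega> in M. \<bar>X i \<omega>\<bar> > u \<bar> X k \<omega> > x \<and> Y l \<omega> > y) < \<delta>"
      unfolding prod.case by blast
    show ?thesis
      by (intro exI[of _ "max N 0"] allI impI cond N) simp_all
  qed
  from bchoice[OF ballI[OF this]] obtain NX where NX:
    "\<forall>i\<in>{1..n} - {k}. \<forall>u\<ge>NX i. \<forall>x\<ge>NX i. \<forall>y\<ge>NX i.
      \<P>(\<omega> in M. \<bar>X i \<omega>\<bar> > u \<and> (X k \<omega> > x \<and> Y l \<omega> > y)) \<le> \<delta> * J k l x y"
    by (rule exE)
  have "\<exists>N. \<forall>u\<ge>N. \<forall>x\<ge>N. \<forall>y\<ge>N.
      \<P>(\<omega> in M. \<bar>Y j \<omega>\<bar> > u \<and> (X k \<omega> > x \<and> Y l \<omega> > y)) \<le> \<delta> * J k l x y"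
    if "j \<in> {1..m} - {l}" for j
  proof -
    have "((\<lambda>(xi, yk, yj). \<P>(\<omega> in M. \<bar>Y j \<omega>\<bar> > yj \<bar> X k \<omega> > xi \<and> Y l \<omega> > yk)) \<longlongrightarrow> 0)
        (at_top \<times>\<^sub>F at_top \<times>\<^sub>F at_top)"
      using gtai that kl unfolding GTAI_def by blast
    then have "\<forall>\<^sub>F z in at_top \<times>\<^sub>F at_top \<times>\<^sub>F at_top.
        (\<lambda>(xi, yk, yj). \<P>(\<omega> in M. \<bar>Y j \<omega>\<bar> > yj \<bar> X k \<omega> > xi \<and> Y l \<omega> > yk)) z < \<delta>"
      by (rule order_tendstoD) (use \<open>\<delta> > 0\<close> in simp)
    from eventually_at_top_prod3[OF this] obtain N where N: "\<And>x y u. x \<ge> N \<Longrightarrow> y \<ge> N \<Longrightarrow> u \<ge> N \<Longrightarrow>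
        \<P>(\<omega> in M. \<bar>Y j \<omega>\<bar> > u \<bar> X k \<omega> > x \<and> Y l \<omega> > y) < \<delta>"
      unfolding prod.case by blast
    show ?thesis
      by (intro exI[of _ "max N 0"] allI impI cond N) simp_all
  qed
  from bchoice[OF ballI[OF this]] obtain NY where NY:
    "\<forall>j\<in>{1..m} - {l}. \<forall>u\<ge>NY j. \<forall>x\<ge>NY j. \<forall>y\<ge>NY j.
      \<P>(\<omega> in M. \<bar>Y j \<omega>\<bar> > u \<and> (X k \<omega> > x \<and> Y l \<omega> > y)) \<le> \<delta> * J k l x y"
    by (rule exE)
  define N where "N = Max (insert 0 (NX ` ({1..n} - {k}) \<union> NY ` ({1..m} - {l})))"
  have N: "\<And>i. i \<in> {1..n} - {k} \<Longrightarrow> NX i \<le> N" "\<And>j. j \<in> {1..m} - {l} \<Longrightarrow> NY j \<le> N"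
    unfolding N_def by (auto intro!: Max_ge)
  show thesis
  proof (rule that)
    fix u x y assume ge: "u \<ge> N" "x \<ge> N" "y \<ge> N"
    let ?B = "\<lambda>\<omega>. X k \<omega> > x \<and> Y l \<omega> > y"
    let ?EX = "\<lambda>i. {\<omega>\<in>space M. \<bar>X i \<omega>\<bar> > u \<and> ?B \<omega>}"
    let ?EY = "\<lambda>j. {\<omega>\<in>space M. \<bar>Y j \<omega>\<bar> > u \<and> ?B \<omega>}"
    note [measurable] = meas(1)[OF kl(1)] meas(2)[OF kl(2)]
    have "\<P>(\<omega> in M. ?B \<omega> \<and> other_exceeds k l u \<omega>)
        \<le> prob ((\<Union>i\<in>{1..n} - {k}. ?EX i) \<union> (\<Union>j\<in>{1..m} - {l}. ?EY j))"
      by (rule finite_measure_mono) (auto simp: other_exceeds_def)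
    also have "\<dots> \<le> prob (\<Union>i\<in>{1..n} - {k}. ?EX i) + prob (\<Union>j\<in>{1..m} - {l}. ?EY j)"
      by (rule measure_Un_le) auto
    also have "\<dots> \<le> (\<Sum>i\<in>{1..n} - {k}. prob (?EX i)) + (\<Sum>j\<in>{1..m} - {l}. prob (?EY j))"
      by (intro add_mono finite_measure_subadditive_finite) auto
    also have "\<dots> \<le> (\<Sum>i\<in>{1..n} - {k}. \<delta> * J k l x y) + (\<Sum>j\<in>{1..m} - {l}. \<delta> * J k l x y)"
      by (intro add_mono sum_mono NX[rule_format] NY[rule_format])
        (auto intro: order_trans[OF N(1)] order_trans[OF N(2)] ge)
    also have "\<dots> \<le> (\<Sum>i\<in>{1..n}. \<delta> * J k l x y) + (\<Sum>j\<in>{1..m}. \<delta> * J k l x y)"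
      using \<open>\<delta> > 0\<close> by (intro add_mono sum_mono2) (auto simp: joint_tail_def)
    also have "\<dots> = (n + m) * \<delta> * J k l x y" by (simp add: algebra_simps)
    also have "\<dots> = \<epsilon> * J k l x y" using nonempty by (simp add: \<delta>_def)
    finally show "\<P>(\<omega> in M. ?B \<omega> \<and> other_exceeds k l u \<omega>) \<le> \<epsilon> * J k l x y" .
  qed
qed

definition lone_jump :: "real \<Rightarrow> real \<Rightarrow> real \<Rightarrow> real \<Rightarrow> nat \<Rightarrow> nat \<Rightarrow> 'a set" where
  "lone_jump u v x y k l =
     {\<omega>\<in>space M. (X k \<omega> > x + v \<and> Y l \<omega> > y + v) \<and> \<not> other_exceeds k l u \<omega>}"

text \<open>
  The first alternative allows for an undershoot of \<open>v\<close>, which the variables below \<open>u\<close> can make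
  up for; the second is all that is known of the largest variables once another one exceeds \<open>u\<close>.
\<close>

definition some_jump :: "real \<Rightarrow> real \<Rightarrow> real \<Rightarrow> real \<Rightarrow> real \<Rightarrow> nat \<Rightarrow> nat \<Rightarrow> 'a set" where
  "some_jump c u v x y k l =
     {\<omega>\<in>space M. (X k \<omega> > x - v \<and> Y l \<omega> > y - v) \<or>
        (X k \<omega> > c * x \<and> Y l \<omega> > c * y) \<and> other_exceeds k l u \<omega>}"

lemma jump_events [measurable]:
  assumes kl: "k \<in> {1..n}" "l \<in> {1..m}"
  shows "lone_jump u v x y k l \<in> events" "some_jump c u v x y k l \<in> events"
proof -
  note [measurable] = meas(1)[OF kl(1)] meas(2)[OF kl(2)]
  show "lone_jump u v x y k l \<in> events" "some_jump c u v x y k l \<in> events"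
    unfolding lone_jump_def some_jump_def by measurable
qed

lemma disjoint_lone_jumps:
  assumes "k \<in> {1..n}" "l \<in> {1..m}" "(k, l) \<noteq> (k', l')" "u \<le> x + v" "u \<le> y + v"
  shows "lone_jump u v x y k l \<inter> lone_jump u v x y k' l' = {}"
proof -
  \<comment> \<open>The large pair of the first event contains a variable that exceeds \<open>u\<close> and is not in
    the second pair.\<close>
  have "other_exceeds k' l' u \<omega>" if "\<omega> \<in> lone_jump u v x y k l" for \<omega>
  proof -
    have "\<bar>X k \<omega>\<bar> > u" "\<bar>Y l \<omega>\<bar> > u" using that assms unfolding lone_jump_def by auto
    then show ?thesis using assms(1-3) unfolding other_exceeds_def by auto
  qed
  then show ?thesis unfolding lone_jump_def[of _ _ _ _ k' l'] by auto
qed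

lemma sums_gt_on_lone_jump:
  fixes u v :: real
  assumes "k \<in> {1..n}" "l \<in> {1..m}" "0 \<le> u" "n * u \<le> v" "m * u \<le> v"
    and \<omega>: "\<omega> \<in> lone_jump u v x y k l"
  shows "(\<Sum>i=1..n. X i \<omega>) > x" "(\<Sum>j=1..m. Y j \<omega>) > y"
proof -
  have "X k \<omega> > x + v" "\<And>i. i \<in> {1..n} - {k} \<Longrightarrow> \<bar>X i \<omega>\<bar> \<le> u"
    "Y l \<omega> > y + v" "\<And>j. j \<in> {1..m} - {l} \<Longrightarrow> \<bar>Y j \<omega>\<bar> \<le> u"
    using \<omega> unfolding lone_jump_def other_exceeds_def by (auto simp: not_less)
  then show "(\<Sum>i=1..n. X i \<omega>) > x" "(\<Sum>j=1..m. Y j \<omega>) > y"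
    using assms(1-5) sum_gt_of_one_large[of "{1..n}" k u v x "\<lambda>i. X i \<omega>"]
      sum_gt_of_one_large[of "{1..m}" l u v y "\<lambda>j. Y j \<omega>"] by simp_all
qed

lemma some_jump_of_sums_gt:
  fixes u v c :: real
  assumes "0 \<le> x" "0 \<le> y" "0 \<le> u" "n * u \<le> v" "m * u \<le> v" "n * c \<le> 1" "m * c \<le> 1"
    and "\<omega> \<in> space M" "(\<Sum>i=1..n. max 0 (X i \<omega>)) > x" "(\<Sum>j=1..m. max 0 (Y j \<omega>)) > y"
  obtains k l where "k \<in> {1..n}" "l \<in> {1..m}" "\<omega> \<in> some_jump c u v x y k l"
proof -
  obtain k where k: "k \<in> {1..n}" "X k \<omega> > c * x"
    "X k \<omega> > x - v \<or> (\<exists>i\<in>{1..n} - {k}. X i \<omega> > u)"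
    by (rule sum_pos_part_gt_cases[of "{1..n}" x u c v "\<lambda>i. X i \<omega>"]) (use assms in auto)
  obtain l where l: "l \<in> {1..m}" "Y l \<omega> > c * y"
    "Y l \<omega> > y - v \<or> (\<exists>j\<in>{1..m} - {l}. Y j \<omega> > u)"
    by (rule sum_pos_part_gt_cases[of "{1..m}" y u c v "\<lambda>j. Y j \<omega>"]) (use assms in auto)
  have "X k \<omega> > x - v \<and> Y l \<omega> > y - v \<or> other_exceeds k l u \<omega>"
    using k(3) l(3) unfolding other_exceeds_def by (meson abs_ge_self less_le_trans)
  then have "\<omega> \<in> some_jump c u v x y k l"
    using k(2) l(2) \<open>\<omega> \<in> space M\<close> unfolding some_jump_def by blast
  then show thesis using k(1) l(1) by (rule that[rotated 2])
qed

text \<open>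
  Only variables beyond the constant level \<open>u\<close> can move a sum by more than a bounded amount, so
  the shift \<open>v\<close> is a constant too and costs nothing in the limit, by long-tailedness. When
  another variable is large, \<open>X k\<close> and \<open>Y l\<close> are only known to exceed the fraction \<open>c\<close> of \<open>x\<close>
  and \<open>y\<close>; dominated variation bounds the loss by a constant factor, and a large \<open>u\<close> beats it.
\<close>

lemma jump_probability_bounds:
  assumes kl: "k \<in> {1..n}" "l \<in> {1..m}" and "\<epsilon> > 0" "c > 0"
  shows "\<exists>N. \<forall>u\<ge>N. \<forall>v>0. \<forall>\<^sub>F (x, y) in at_top \<times>\<^sub>F at_top.
      (1 - \<epsilon>) * J k l x y \<le> prob (lone_jump u v x y k l) \<and>
      prob (some_jump c u v x y k l) \<le> (1 + \<epsilon>) * J k l x y"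
proof -
  note [measurable] = meas(1)[OF kl(1)] meas(2)[OF kl(2)]
  note J_pos = joint_tail_pos[OF kl]
  obtain C where C: "C > 0"
    "\<forall>\<^sub>F (x, y) in at_top \<times>\<^sub>F at_top. J k l (c * x) (c * y) \<le> C * J k l x y"
    using dominatedly_varying2_scale[OF meas(1)[OF kl(1)] meas(2)[OF kl(2)] J_pos dominated[OF kl] \<open>c > 0\<close>]
    by blast
  then obtain K where K: "\<And>x y. x \<ge> K \<Longrightarrow> y \<ge> K \<Longrightarrow> J k l (c * x) (c * y) \<le> C * J k l x y"
    unfolding eventually_at_top_prod2 by auto
  \<comment> \<open>The part \<open>\<epsilon> / (2 * C)\<close> pays for the factor \<open>C\<close> in the upper bound; two terms
    of size \<open>\<epsilon> / 2\<close>, from the shift and from the other variables, add up to \<open>\<epsilon>\<close> in both.\<close>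
  define \<delta> where "\<delta> = min (\<epsilon> / 2) (\<epsilon> / (2 * C))"
  have \<delta>: "\<delta> > 0" "\<delta> \<le> \<epsilon> / 2" "C * \<delta> \<le> \<epsilon> / 2"
    using C(1) \<open>\<epsilon> > 0\<close> by (auto simp: \<delta>_def min_def field_simps)
  obtain N where N: "\<And>u x y. u \<ge> N \<Longrightarrow> x \<ge> N \<Longrightarrow> y \<ge> N \<Longrightarrow>
      \<P>(\<omega> in M. (X k \<omega> > x \<and> Y l \<omega> > y) \<and> other_exceeds k l u \<omega>) \<le> \<delta> * J k l x y"
    using other_exceeds_negligible[OF kl \<delta>(1)] by blast
  show ?thesis
  proof (intro exI[of _ N] allI impI)
    fix u v :: real assume "u \<ge> N" "v > 0"
    obtain L where L: "\<And>x y. x \<ge> L \<Longrightarrow> y \<ge> L \<Longrightarrow> J k l (x - v) (y - v) \<le> (1 + \<delta>) * J k l x y"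
      using long_tailed2_shift[OF J_pos long[OF kl] \<open>v > 0\<close> \<delta>(1)]
      unfolding eventually_at_top_prod2 by auto
    define R where "R = Max {0, K, L, N, N / c}"
    have R: "0 \<le> R" "K \<le> R" "L \<le> R" "N \<le> R" "N / c \<le> R" by (auto simp: R_def)
    have "(1 - \<epsilon>) * J k l x y
        \<le> \<P>(\<omega> in M. (X k \<omega> > x + v \<and> Y l \<omega> > y + v) \<and> \<not> other_exceeds k l u \<omega>)" (is "_ \<le> ?lhs")
      if xy: "x \<ge> R" "y \<ge> R" for x y
    proof -
      let ?B = "\<lambda>\<omega>. X k \<omega> > x + v \<and> Y l \<omega> > y + v"
      have "J k l (x + v) (y + v)
          = prob ({\<omega>\<in>space M. ?B \<omega> \<and> \<not> other_exceeds k l u \<omega>} \<union>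
                  {\<omega>\<in>space M. ?B \<omega> \<and> other_exceeds k l u \<omega>})"
        unfolding joint_tail_def by (rule arg_cong[where f = prob]) auto
      also have "\<dots> \<le> ?lhs + \<P>(\<omega> in M. ?B \<omega> \<and> other_exceeds k l u \<omega>)"
        by (rule measure_Un_le) auto
      also have "\<dots> \<le> ?lhs + \<delta> * J k l (x + v) (y + v)"
        using N[OF \<open>u \<ge> N\<close>, of "x + v" "y + v"] xy R \<open>v > 0\<close> by simp
      finally have *: "(1 - \<delta>) * J k l (x + v) (y + v) \<le> ?lhs" by (simp add: algebra_simps)
      show ?thesis
      proof (cases "\<epsilon> \<le> 1")
        case True
        have "J k l x y \<le> (1 + \<delta>) * J k l (x + v) (y + v)"
          using L[of "x + v" "y + v"] xy R \<open>v > 0\<close> by simp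
        then have "(1 - \<epsilon>) * J k l x y \<le> (1 - \<epsilon>) * ((1 + \<delta>) * J k l (x + v) (y + v))"
          using True by (intro mult_left_mono) auto
        also have "\<dots> = ((1 - \<epsilon>) * (1 + \<delta>)) * J k l (x + v) (y + v)" by simp
        also have "\<dots> \<le> (1 - \<delta>) * J k l (x + v) (y + v)"
        proof (rule mult_right_mono)
          have "(1 - \<epsilon>) * (1 + \<delta>) = 1 - \<epsilon> + \<delta> - \<epsilon> * \<delta>" by (simp add: algebra_simps)
          then show "(1 - \<epsilon>) * (1 + \<delta>) \<le> 1 - \<delta>"
            using \<delta> mult_pos_pos[OF \<open>\<epsilon> > 0\<close> \<delta>(1)] by linarith
        qed (simp add: joint_tail_def)
        finally show ?thesis using * by simp
      next
        case False
        then have "(1 - \<epsilon>) * J k l x y \<le> 0"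
          by (intro mult_nonpos_nonneg) (auto simp: joint_tail_def)
        then show ?thesis by (rule order_trans) simp
      qed
    qed
    moreover have "\<P>(\<omega> in M. (X k \<omega> > x - v \<and> Y l \<omega> > y - v) \<or>
          (X k \<omega> > c * x \<and> Y l \<omega> > c * y) \<and> other_exceeds k l u \<omega>) \<le> (1 + \<epsilon>) * J k l x y"
      if xy: "x \<ge> R" "y \<ge> R" for x y
    proof -
      let ?B = "\<lambda>\<omega>. X k \<omega> > c * x \<and> Y l \<omega> > c * y"
      have "N / c \<le> x" "N / c \<le> y" using xy R(5) by auto
      then have "N \<le> c * x" "N \<le> c * y" using \<open>c > 0\<close> by (auto simp: field_simps)
      then have "\<P>(\<omega> in M. ?B \<omega> \<and> other_exceeds k l u \<omega>) \<le> \<delta> * J k l (c * x) (c * y)"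
        by (rule N[OF \<open>u \<ge> N\<close>])
      also have "\<dots> \<le> \<delta> * (C * J k l x y)"
        using K xy R \<delta> by (intro mult_left_mono) auto
      also have "\<dots> = (C * \<delta>) * J k l x y" by simp
      also have "\<dots> \<le> \<epsilon> / 2 * J k l x y"
        using \<delta> by (intro mult_right_mono) (auto simp: joint_tail_def)
      finally have far: "\<P>(\<omega> in M. ?B \<omega> \<and> other_exceeds k l u \<omega>) \<le> \<epsilon> / 2 * J k l x y" .
      have "J k l (x - v) (y - v) \<le> (1 + \<delta>) * J k l x y"
        using L xy R by simp
      also have "\<dots> \<le> (1 + \<epsilon> / 2) * J k l x y"
        using \<delta> by (intro mult_right_mono) (auto simp: joint_tail_def)
      finally have near: "J k l (x - v) (y - v) \<le> (1 + \<epsilon> / 2) * J k l x y" .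
      have "\<P>(\<omega> in M. (X k \<omega> > x - v \<and> Y l \<omega> > y - v) \<or> ?B \<omega> \<and> other_exceeds k l u \<omega>)
          = prob ({\<omega>\<in>space M. X k \<omega> > x - v \<and> Y l \<omega> > y - v} \<union>
                  {\<omega>\<in>space M. ?B \<omega> \<and> other_exceeds k l u \<omega>})"
        by (rule arg_cong[where f = prob]) auto
      also have "\<dots> \<le> J k l (x - v) (y - v) + \<P>(\<omega> in M. ?B \<omega> \<and> other_exceeds k l u \<omega>)"
        unfolding joint_tail_def by (rule measure_Un_le) auto
      also have "\<dots> \<le> (1 + \<epsilon> / 2) * J k l x y + \<epsilon> / 2 * J k l x y"
        using near far by simp
      also have "\<dots> = (1 + \<epsilon>) * J k l x y" by (simp add: algebra_simps add_divide_distrib[symmetric])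
      finally show ?thesis .
    qed
    ultimately show "\<forall>\<^sub>F (x, y) in at_top \<times>\<^sub>F at_top.
      (1 - \<epsilon>) * J k l x y \<le> prob (lone_jump u v x y k l) \<and>
      prob (some_jump c u v x y k l) \<le> (1 + \<epsilon>) * J k l x y"
      unfolding eventually_at_top_prod2 lone_jump_def some_jump_def
      by (intro exI[of _ R]) auto
  qed
qed

lemma sum_joint_tails_pos:
  "\<forall>\<^sub>F (x, y) in at_top \<times>\<^sub>F at_top. (\<Sum>k=1..n. \<Sum>l=1..m. J k l x y) > 0"
  unfolding eventually_at_top_prod2 using nonempty
  by (intro exI[of _ 0]) (auto intro!: sum_pos joint_tail_pos)

text \<open>
  The first hypothesis on \<open>E\<close> makes it contain all lone jumps, whose probabilities add up because
  they are disjoint; by the second it is covered by the events \<open>some_jump\<close>. The hypotheses are weak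
  enough for the sums, the maximal partial sums and the maxima alike.
\<close>

lemma asymp2_sum_joint_tails:
  assumes [measurable]: "\<And>x y. E x y \<in> events"
    and contains: "\<And>x y k l \<omega>. \<omega> \<in> space M \<Longrightarrow> k \<in> {1..n} \<Longrightarrow> l \<in> {1..m} \<Longrightarrow>
      X k \<omega> > x \<Longrightarrow> Y l \<omega> > y \<Longrightarrow> (\<Sum>i=1..n. X i \<omega>) > x \<Longrightarrow> (\<Sum>j=1..m. Y j \<omega>) > y \<Longrightarrow> \<omega> \<in> E x y"
    and contained: "\<And>x y \<omega>. x \<ge> 0 \<Longrightarrow> y \<ge> 0 \<Longrightarrow> \<omega> \<in> E x y \<Longrightarrow>
      \<omega> \<in> space M \<and> (\<Sum>i=1..n. max 0 (X i \<omega>)) > x \<and> (\<Sum>j=1..m. max 0 (Y j \<omega>)) > y"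
  shows "asymp2 (\<lambda>x y. prob (E x y)) (\<lambda>x y. \<Sum>k=1..n. \<Sum>l=1..m. J k l x y)"
proof -
  let ?h = "\<lambda>x y. \<Sum>k=1..n. \<Sum>l=1..m. J k l x y"
  let ?I = "{1..n} \<times> {1..m}"
  define c :: real where "c = 1 / (n + m)"
  have c: "c > 0" "n * c \<le> 1" "m * c \<le> 1" using nonempty by (auto simp: c_def field_simps)
  have h: "?h x y = (\<Sum>(k, l)\<in>?I. J k l x y)" for x y
    by (rule sum.cartesian_product)
  have bounds: "\<forall>\<^sub>F (x, y) in at_top \<times>\<^sub>F at_top.
      (1 - \<epsilon>) * ?h x y \<le> prob (E x y) \<and> prob (E x y) \<le> (1 + \<epsilon>) * ?h x y" if "\<epsilon> > 0" for \<epsilon>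
  proof -
    have "\<forall>p\<in>?I. \<exists>N. \<forall>u\<ge>N. \<forall>v>0. \<forall>\<^sub>F (x, y) in at_top \<times>\<^sub>F at_top.
        (1 - \<epsilon>) * J (fst p) (snd p) x y \<le> prob (lone_jump u v x y (fst p) (snd p)) \<and>
        prob (some_jump c u v x y (fst p) (snd p)) \<le> (1 + \<epsilon>) * J (fst p) (snd p) x y"
      by (intro ballI jump_probability_bounds \<open>\<epsilon> > 0\<close> c(1)) (simp_all add: mem_Times_iff)
    from bchoice[OF this] obtain N where N: "\<forall>p\<in>?I. \<forall>u\<ge>N p. \<forall>v>0.
      \<forall>\<^sub>F (x, y) in at_top \<times>\<^sub>F at_top.
        (1 - \<epsilon>) * J (fst p) (snd p) x y \<le> prob (lone_jump u v x y (fst p) (snd p)) \<and>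
        prob (some_jump c u v x y (fst p) (snd p)) \<le> (1 + \<epsilon>) * J (fst p) (snd p) x y"
      by (rule exE)
    define u where "u = Max (insert 1 (N ` ?I))"
    \<comment> \<open>With this \<open>v\<close>, variables below \<open>u\<close> contribute at most \<open>v\<close> to either sum, and
      \<open>u \<le> v\<close> makes the lone jumps disjoint as soon as \<open>x\<close> and \<open>y\<close> are nonnegative.\<close>
    define v where "v = (n + m) * u"
    have u: "N p \<le> u" if "p \<in> ?I" for p
      unfolding u_def using that by (auto intro!: Max_ge simp del: Max_insert)
    have u1: "u \<ge> 1" unfolding u_def by (auto intro!: Max_ge simp del: Max_insert)
    have v: "v > 0" "n * u \<le> v" "m * u \<le> v" "u \<le> v"
    proof -
      show "n * u \<le> v" "m * u \<le> v" using u1 by (auto simp: v_def intro!: mult_right_mono)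
      have "1 * u \<le> v" unfolding v_def using u1 nonempty by (intro mult_right_mono) auto
      then show "u \<le> v" "v > 0" using u1 by auto
    qed
    have "\<forall>\<^sub>F z in at_top \<times>\<^sub>F at_top. \<forall>p\<in>?I. case z of (x, y) \<Rightarrow>
        (1 - \<epsilon>) * J (fst p) (snd p) x y \<le> prob (lone_jump u v x y (fst p) (snd p)) \<and>
        prob (some_jump c u v x y (fst p) (snd p)) \<le> (1 + \<epsilon>) * J (fst p) (snd p) x y"
      by (rule eventually_ball_finite) (simp, intro ballI N[rule_format] u v)
    moreover have "\<forall>\<^sub>F z in at_top \<times>\<^sub>F at_top. fst z \<ge> (0::real) \<and> snd z \<ge> (0::real)"
      unfolding eventually_at_top_prod2 by (intro exI[of _ 0]) auto
    ultimately show ?thesis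
    proof eventually_elim
      case (elim z)
      obtain x y where z: "z = (x, y)" by force
      have xy: "x \<ge> 0" "y \<ge> 0" using elim(2) z by auto
      define A where "A p = lone_jump u v x y (fst p) (snd p)" for p
      define B where "B p = some_jump c u v x y (fst p) (snd p)" for p
      have AB: "(1 - \<epsilon>) * J (fst p) (snd p) x y \<le> prob (A p)"
        "prob (B p) \<le> (1 + \<epsilon>) * J (fst p) (snd p) x y" if "p \<in> ?I" for p
        using elim(1) that unfolding z A_def B_def by auto
      have AB_ev: "A p \<in> events" "B p \<in> events" if "p \<in> ?I" for p
        unfolding A_def B_def using that by (auto intro!: jump_events)
      have "(1 - \<epsilon>) * ?h x y = (\<Sum>p\<in>?I. (1 - \<epsilon>) * J (fst p) (snd p) x y)"
        by (simp only: h sum_distrib_left case_prod_unfold)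
      also have "\<dots> \<le> (\<Sum>p\<in>?I. prob (A p))" by (intro sum_mono AB)
      also have "\<dots> = prob (\<Union>p\<in>?I. A p)"
      proof (rule finite_measure_finite_Union[symmetric])
        show "disjoint_family_on A ?I"
          unfolding disjoint_family_on_def A_def
        proof (intro ballI impI)
          fix p q assume "p \<in> ?I" "q \<in> ?I" "p \<noteq> q"
          then show "lone_jump u v x y (fst p) (snd p) \<inter> lone_jump u v x y (fst q) (snd q) = {}"
            using xy v(4) by (intro disjoint_lone_jumps) (auto simp: prod_eq_iff)
        qed
      qed (use AB_ev in auto)
      also have "\<dots> \<le> prob (E x y)"
      proof (rule finite_measure_mono)
        show "(\<Union>p\<in>?I. A p) \<subseteq> E x y"
        proof
          fix \<omega> assume "\<omega> \<in> (\<Union>p\<in>?I. A p)"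
          then obtain k l where kl: "k \<in> {1..n}" "l \<in> {1..m}" and \<omega>: "\<omega> \<in> lone_jump u v x y k l"
            unfolding A_def by fastforce
          have "\<omega> \<in> space M" "X k \<omega> > x" "Y l \<omega> > y"
            using \<omega> v(1) unfolding lone_jump_def by auto
          moreover have "(\<Sum>i=1..n. X i \<omega>) > x" "(\<Sum>j=1..m. Y j \<omega>) > y"
            using sums_gt_on_lone_jump[OF kl _ v(2,3) \<omega>] u1 by auto
          ultimately show "\<omega> \<in> E x y" using contains kl by blast
        qed
      qed simp
      finally have lower: "(1 - \<epsilon>) * ?h x y \<le> prob (E x y)" .
      have "prob (E x y) \<le> prob (\<Union>p\<in>?I. B p)"
      proof (rule finite_measure_mono)
        show "E x y \<subseteq> (\<Union>p\<in>?I. B p)"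
        proof
          fix \<omega> assume "\<omega> \<in> E x y"
          note \<omega> = contained[OF xy this]
          obtain k l where "k \<in> {1..n}" "l \<in> {1..m}" "\<omega> \<in> some_jump c u v x y k l"
            by (rule some_jump_of_sums_gt[OF xy _ v(2,3) c(2,3)]) (use \<omega> u1 in auto)
          then show "\<omega> \<in> (\<Union>p\<in>?I. B p)" unfolding B_def by force
        qed
        show "(\<Union>p\<in>?I. B p) \<in> events" using AB_ev by (intro sets.finite_UN) auto
      qed
      also have "\<dots> \<le> (\<Sum>p\<in>?I. prob (B p))"
        by (rule finite_measure_subadditive_finite) (use AB_ev in auto)
      also have "\<dots> \<le> (\<Sum>p\<in>?I. (1 + \<epsilon>) * J (fst p) (snd p) x y)" by (intro sum_mono AB)
      also have "\<dots> = (1 + \<epsilon>) * ?h x y"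
        by (simp only: h sum_distrib_left case_prod_unfold)
      finally show ?case using lower unfolding z by simp
    qed
  qed
  show ?thesis using sum_joint_tails_pos bounds by (rule asymp2I)
qed

end

section \<open>Joint tails of sums and maxima\<close>

theorem theorem4p2:
  fixes M :: "'a measure" and n :: nat
    and X Y :: "nat \<Rightarrow> 'a \<Rightarrow> real"
    and F G :: "nat \<Rightarrow> real \<Rightarrow> real"
  assumes "prob_space M" and "n \<ge> 1"
    and "\<And>k. k \<in> {1..n} \<Longrightarrow> X k \<in> borel_measurable M"
    and "\<And>l. l \<in> {1..n} \<Longrightarrow> Y l \<in> borel_measurable M"
    and "\<And>k. k \<in> {1..n} \<Longrightarrow> F k = cdf (distr M borel (X k))"
    and "\<And>l. l \<in> {1..n} \<Longrightarrow> G l = cdf (distr M borel (Y l))"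
    and "\<And>k x. k \<in> {1..n} \<Longrightarrow> x \<ge> 0 \<Longrightarrow> 1 - F k x > 0"
    and "\<And>l y. l \<in> {1..n} \<Longrightarrow> y \<ge> 0 \<Longrightarrow> 1 - G l y > 0"
    and "\<And>k l x y. k \<in> {1..n} \<Longrightarrow> l \<in> {1..n} \<Longrightarrow> x \<ge> 0 \<Longrightarrow> y \<ge> 0
           \<Longrightarrow> joint_tail M (X k) (Y l) x y > 0"
    and "\<And>k. k \<in> {1..n} \<Longrightarrow> dominatedly_varying (F k) \<and> long_tailed (F k)"
    and "\<And>l. l \<in> {1..n} \<Longrightarrow> dominatedly_varying (G l) \<and> long_tailed (G l)"
    and "GTAI M n n X Y"
    and "\<And>k l. k \<in> {1..n} \<Longrightarrow> l \<in> {1..n}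
           \<Longrightarrow> dominatedly_varying2 M (X k) (Y l) \<and> long_tailed2 M (X k) (Y l)"
    and "TAI M n X" and "TAI M n Y"
  defines "S \<equiv> \<lambda>i \<omega>. \<Sum>k=1..i. X k \<omega>"
    and "T \<equiv> \<lambda>j \<omega>. \<Sum>l=1..j. Y l \<omega>"
  shows "asymp2
           (\<lambda>x y. \<P>(\<omega> in M. (\<Sum>k=1..n. X k \<omega>) > x \<and> (\<Sum>l=1..n. Y l \<omega>) > y))
           (\<lambda>x y. \<P>(\<omega> in M. (MAX i\<in>{1..n}. S i \<omega>) > x \<and> (MAX j\<in>{1..n}. T j \<omega>) > y)) \<and>
         asymp2
           (\<lambda>x y. \<P>(\<omega> in M. (MAX i\<in>{1..n}. S i \<omega>) > x \<and> (MAX j\<in>{1..n}. T j \<omega>) > y))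
           (\<lambda>x y. \<P>(\<omega> in M. (MAX k\<in>{1..n}. X k \<omega>) > x \<and> (MAX l\<in>{1..n}. Y l \<omega>) > y)) \<and>
         asymp2
           (\<lambda>x y. \<P>(\<omega> in M. (MAX k\<in>{1..n}. X k \<omega>) > x \<and> (MAX l\<in>{1..n}. Y l \<omega>) > y))
           (\<lambda>x y. \<Sum>k=1..n. \<Sum>l=1..n. \<P>(\<omega> in M. X k \<omega> > x \<and> Y l \<omega> > y))"
proof -
  interpret prob_space M by fact
  interpret gtai_families M n n X Y
    using assms(2,3,4,9,12,13) by unfold_locales auto
  let ?h = "\<lambda>x y. \<Sum>k=1..n. \<Sum>l=1..n. J k l x y"
  have sum_le: "(\<Sum>k=1..n. Z k \<omega>) \<le> (\<Sum>k=1..n. max 0 (Z k \<omega>))" for Z :: "nat \<Rightarrow> 'a \<Rightarrow> real" and \<omega>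
    by (intro sum_mono) auto
  have max_le: "(MAX k\<in>{1..n}. Z k \<omega>) \<le> (\<Sum>k=1..n. max 0 (Z k \<omega>))" for Z :: "nat \<Rightarrow> 'a \<Rightarrow> real" and \<omega>
  proof -
    have "Z k \<omega> \<le> (\<Sum>k=1..n. max 0 (Z k \<omega>))" if "k \<in> {1..n}" for k
      using member_le_sum[of k "{1..n}" "\<lambda>k. max 0 (Z k \<omega>)"] that by simp
    then show ?thesis using \<open>n \<ge> 1\<close> by (subst Max_le_iff) auto
  qed
  have sums: "asymp2 (\<lambda>x y. \<P>(\<omega> in M. (\<Sum>k=1..n. X k \<omega>) > x \<and> (\<Sum>l=1..n. Y l \<omega>) > y)) ?h"
    by (rule asymp2_sum_joint_tails) (auto intro: less_le_trans[OF _ sum_le] simp del: One_nat_def)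
  have partial_sums: "asymp2
      (\<lambda>x y. \<P>(\<omega> in M. (MAX i\<in>{1..n}. S i \<omega>) > x \<and> (MAX j\<in>{1..n}. T j \<omega>) > y)) ?h"
  proof (rule asymp2_sum_joint_tails)
    have [measurable]: "S i \<in> borel_measurable M" "T i \<in> borel_measurable M" if "i \<in> {1..n}" for i
      using that unfolding S_def T_def by (auto intro!: borel_measurable_sum meas)
    show "{\<omega> \<in> space M. (MAX i\<in>{1..n}. S i \<omega>) > x \<and> (MAX j\<in>{1..n}. T j \<omega>) > y} \<in> events" for x y
      by measurable
  next
    fix x y \<omega> assume "\<omega> \<in> space M" "(\<Sum>i=1..n. X i \<omega>) > x" "(\<Sum>j=1..n. Y j \<omega>) > y"
    then show "\<omega> \<in> {\<omega> \<in> space M. (MAX i\<in>{1..n}. S i \<omega>) > x \<and> (MAX j\<in>{1..n}. T j \<omega>) > y}"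
      using \<open>n \<ge> 1\<close> unfolding S_def T_def by (auto simp: Max_gr_iff)
  qed (auto simp: S_def T_def simp del: One_nat_def
      intro: less_le_trans[OF _ Max_partial_sums_le_sum_pos_part[OF \<open>n \<ge> 1\<close>]])
  have maxima: "asymp2
      (\<lambda>x y. \<P>(\<omega> in M. (MAX k\<in>{1..n}. X k \<omega>) > x \<and> (MAX l\<in>{1..n}. Y l \<omega>) > y)) ?h"
  proof (rule asymp2_sum_joint_tails)
    fix x y k l \<omega> assume "\<omega> \<in> space M" "k \<in> {1..n}" "l \<in> {1..n}" "X k \<omega> > x" "Y l \<omega> > y"
    then show "\<omega> \<in> {\<omega> \<in> space M. (MAX k\<in>{1..n}. X k \<omega>) > x \<and> (MAX l\<in>{1..n}. Y l \<omega>) > y}"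
      using \<open>n \<ge> 1\<close> by (auto simp: Max_gr_iff)
  qed (auto intro: less_le_trans[OF _ max_le] simp del: One_nat_def)
  show ?thesis
    using asymp2_trans_common[OF sums partial_sums sum_joint_tails_pos]
      asymp2_trans_common[OF partial_sums maxima sum_joint_tails_pos] maxima
    by (simp add: joint_tail_def)
qed

end
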